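(* Let $(X,\mathcal{E})$ be an infinite finitary coarse space (that is, a finitary coarse space whose underlying set $X$ is infinite). Then the following statements are equivalent: (i) every permutation of $X$ is an asymorphism of $(X,\mathcal{E})$ (onto itself); (ii) there exists an infinite cardinal $\kappa$ with $\kappa\leq |X|^+$ such that $(X,\mathcal{E})=X_G$ for $G=\mathcal{S}_X^{<\kappa}$.
   Context: A coarse structure on a set $X$ is a family $\mathcal{E}$ of subsets of $X\times X$ such that: (1) each $E\in\mathcal{E}$ contains the diagonal $\triangle_X=\{(x,x): x\in X\}$; (2) if $E,E'\in\mathcal{E}$ then $E\circ E'\in\mathcal{E}$ and $E^{-1}\in\mathcal{E}$, where $E\circ E'=\{(x,y): \exists z\ ((x,z)\in E,\ (z,y)\in E')\}$ and $E^{-1}=\{(y,x): (x,y)\in E\}$; (3) if $E\in\mathcal{E}$ and $\triangle_X\subseteq E'\subseteq E$ then $E'\in\mathcal{E}$; (4) $\bigcup\mathcal{E}=X\times X$. The pair $(X,\mathcal{E})$ is called a coarse space. A subfamily $\mathcal{E}'\subseteq\mathcal{E}$ is a base for $\mathcal{E}$ if for every $E\in\mathcal{E}$ there exists $E'\in\mathcal{E}'$ with $E\subseteq E'$. For $x\in X$ and $E\in\mathcal{E}$, put $E[x]=\{y\in X: (x,y)\in E\}$. A coarse space $(X,\mathcal{E})$ is finitary if for each $E\in\mathcal{E}$ there exists a natural number $n$ such that $|E[x]|<n$ for each $x\in X$. A mapping $f: X\to X'$ between coarse spaces $(X,\mathcal{E})$ and $(X',\mathcal{E}')$ is macro-uniform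 if for each $E\in\mathcal{E}$ there exists $E'\in\mathcal{E}'$ such that, for all $x,y\in X$, $(x,y)\in E$ implies $(f(x),f(y))\in E'$. It is an asymorphism if $f$ is a bijection and both $f$ and $f^{-1}$ are macro-uniform. For a transitive group $G$ of permutations of a set $X$, $X_G$ denotes the set $X$ endowed with the coarse structure with the base consisting of the sets $\{(x,gx): x\in X,\ g\in F\}$, where $F$ ranges over all finite subsets of $G$ containing the identity permutation $\mathrm{id}$. $\mathcal{S}_X$ denotes the group of all permutations of $X$; for $g\in\mathcal{S}_X$, $\mathrm{supp}\, g=\{x\in X: g(x)\neq x\}$; for a cardinal $\kappa$, $\mathcal{S}_X^{<\kappa}=\{g\in\mathcal{S}_X: |\mathrm{supp}\, g|<\kappa\}$. $|X|^+$ denotes the successor cardinal of $|X|$. *)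

theory Defs
  imports "HOL-Combinatorics.Permutations"
begin

unbundle cardinal_syntax

definition coarse_structure :: "'a set \<Rightarrow> 'a rel set \<Rightarrow> bool" where
  "coarse_structure X \<E> \<longleftrightarrow>
     (\<forall>E\<in>\<E>. E \<subseteq> X \<times> X \<and> Id_on X \<subseteq> E) \<and>
     (\<forall>E\<in>\<E>. \<forall>E'\<in>\<E>. E O E' \<in> \<E>) \<and>
     (\<forall>E\<in>\<E>. E\<inverse> \<in> \<E>) \<and>
     (\<forall>E\<in>\<E>. \<forall>E'. Id_on X \<subseteq> E' \<and> E' \<subseteq> E \<longrightarrow> E' \<in> \<E>) \<and>
     \<Union>\<E> = X \<times> X"

definition coarse_base :: "'a rel set \<Rightarrow> 'a rel set \<Rightarrow> bool" where
  "coarse_base \<B> \<E> \<longleftrightarrow> \<B> \<subseteq> \<E> \<and> (\<forall>E\<in>\<E>. \<exists>B\<in>\<B>. E \<subseteq> B)"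

text \<open>The entourages \<open>E\<close> are relations on \<open>X\<close>, so \<open>E[x]\<close> is \<open>E `` {x}\<close>. Finiteness is
  stated separately because \<^const>\<open>card\<close> is \<open>0\<close> on infinite sets.\<close>

definition finitary :: "'a set \<Rightarrow> 'a rel set \<Rightarrow> bool" where
  "finitary X \<E> \<longleftrightarrow> (\<forall>E\<in>\<E>. \<exists>n. \<forall>x\<in>X. finite (E `` {x}) \<and> card (E `` {x}) < n)"

definition macro_uniform ::
  "'a set \<Rightarrow> 'a rel set \<Rightarrow> 'b set \<Rightarrow> 'b rel set \<Rightarrow> ('a \<Rightarrow> 'b) \<Rightarrow> bool" where
  "macro_uniform X \<E> X' \<E>' f \<longleftrightarrow>
     f ` X \<subseteq> X' \<and>
     (\<forall>E\<in>\<E>. \<exists>E'\<in>\<E>'. \<forall>x\<in>X. \<forall>y\<in>X. (x, y) \<in> E \<longrightarrow> (f x, f y) \<in> E')"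

definition asymorphism ::
  "'a set \<Rightarrow> 'a rel set \<Rightarrow> 'b set \<Rightarrow> 'b rel set \<Rightarrow> ('a \<Rightarrow> 'b) \<Rightarrow> bool" where
  "asymorphism X \<E> X' \<E>' f \<longleftrightarrow>
     bij_betw f X X' \<and> macro_uniform X \<E> X' \<E>' f \<and> macro_uniform X' \<E>' X \<E> (inv_into X f)"

text \<open>A permutation of \<open>X\<close> is a function on the whole type that satisfies \<open>g permutes X\<close>,
  i.e. it is extended by the identity outside \<open>X\<close>.\<close>

definition transitive_permutation_group :: "'a set \<Rightarrow> ('a \<Rightarrow> 'a) set \<Rightarrow> bool" where
  "transitive_permutation_group X G \<longleftrightarrow>
     (\<forall>g\<in>G. g permutes X) \<and> id \<in> G \<and>
     (\<forall>g\<in>G. \<forall>h\<in>G. g \<circ> h \<in> G) \<and> (\<forall>g\<in>G. inv g \<in> G) \<and>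
     (\<forall>x\<in>X. \<forall>y\<in>X. \<exists>g\<in>G. g x = y)"

definition group_base :: "'a set \<Rightarrow> ('a \<Rightarrow> 'a) set \<Rightarrow> 'a rel set" where
  "group_base X G = {{(x, g x) | x g. x \<in> X \<and> g \<in> F} | F. finite F \<and> F \<subseteq> G \<and> id \<in> F}"

text \<open>The coarse structure of \<open>X\<^sub>G\<close>. For a transitive permutation group \<open>G\<close> it is the unique
  coarse structure on \<open>X\<close> with base \<open>group_base X G\<close>; see the lemmas below.\<close>

definition group_coarse :: "'a set \<Rightarrow> ('a \<Rightarrow> 'a) set \<Rightarrow> 'a rel set" where
  "group_coarse X G = {E. Id_on X \<subseteq> E \<and> (\<exists>B\<in>group_base X G. E \<subseteq> B)}"

definition supp :: "'a set \<Rightarrow> ('a \<Rightarrow> 'a) \<Rightarrow> 'a set" where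
  "supp X g = {x\<in>X. g x \<noteq> x}"

text \<open>\<open>\<S>\<^sub>X\<^sup><\<^sup>\<kappa>\<close>, with the cardinal \<open>\<kappa>\<close> given as a cardinal order relation.\<close>

definition perms_below :: "'a set \<Rightarrow> 'k rel \<Rightarrow> ('a \<Rightarrow> 'a) set" where
  "perms_below X \<kappa> = {g. g permutes X \<and> |supp X g| <o \<kappa>}"

lemma group_coarse_unique:
  assumes "coarse_structure X \<E>" "coarse_base (group_base X G) \<E>"
  shows "\<E> = group_coarse X G"
proof (rule set_eqI, rule iffI)
  fix E assume E: "E \<in> \<E>"
  have "Id_on X \<subseteq> E" using assms(1) E by (simp add: coarse_structure_def)
  moreover have "\<exists>B\<in>group_base X G. E \<subseteq> B" using assms(2) E by (simp add: coarse_base_def)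
  ultimately show "E \<in> group_coarse X G" by (simp add: group_coarse_def)
next
  fix E assume "E \<in> group_coarse X G"
  then obtain B where B: "Id_on X \<subseteq> E" "B \<in> group_base X G" "E \<subseteq> B"
    by (auto simp: group_coarse_def)
  then have "B \<in> \<E>" using assms(2) by (auto simp: coarse_base_def)
  moreover have "\<forall>B\<in>\<E>. \<forall>E'. Id_on X \<subseteq> E' \<and> E' \<subseteq> B \<longrightarrow> E' \<in> \<E>"
    using assms(1) unfolding coarse_structure_def by (elim conjE)
  ultimately show "E \<in> \<E>" using B(1,3) by simp
qed

lemma group_coarse_iff:
  fixes X :: "'a set"
  shows
  "E \<in> group_coarse X G \<longleftrightarrow>
     Id_on X \<subseteq> E \<and>
     (\<exists>F. finite F \<and> F \<subseteq> G \<and> id \<in> F \<and> E \<subseteq> {(x, g x) | x g. x \<in> X \<and> g \<in> F})"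
proof -
  have *: "(\<exists>B\<in>{f F | F. P F}. E \<subseteq> B) \<longleftrightarrow> (\<exists>F. P F \<and> E \<subseteq> f F)"
    for P :: "('a \<Rightarrow> 'a) set \<Rightarrow> bool" and f :: "('a \<Rightarrow> 'a) set \<Rightarrow> 'a rel"
    by blast
  show ?thesis
    unfolding group_coarse_def group_base_def mem_Collect_eq * conj_assoc ..
qed

lemma group_coarseE:
  assumes "E \<in> group_coarse X G"
  obtains F where "finite F" "F \<subseteq> G" "id \<in> F" "Id_on X \<subseteq> E"
    "E \<subseteq> {(x, g x) | x g. x \<in> X \<and> g \<in> F}"
  using assms unfolding group_coarse_iff by (elim conjE exE) rule

lemma group_coarseI:
  assumes "finite F" "F \<subseteq> G" "id \<in> F" "Id_on X \<subseteq> E"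
    "E \<subseteq> {(x, g x) | x g. x \<in> X \<and> g \<in> F}"
  shows "E \<in> group_coarse X G"
  unfolding group_coarse_iff by (intro conjI exI[of _ F] assms)

lemma coarse_base_group_coarse: "coarse_base (group_base X G) (group_coarse X G)"
  unfolding coarse_base_def
proof (intro conjI ballI subsetI)
  fix B assume B: "B \<in> group_base X G"
  then obtain F where "B = {(x, g x) | x g. x \<in> X \<and> g \<in> F}" "id \<in> F"
    unfolding group_base_def by (elim CollectE exE conjE) rule
  then have "(x, x) \<in> B" if "x \<in> X" for x
    using that by (metis (mono_tags, lifting) id_apply mem_Collect_eq)
  then have "Id_on X \<subseteq> B" by (simp add: Id_on_def UN_subset_iff)
  then show "B \<in> group_coarse X G" using B by (auto simp: group_coarse_def)
qed (simp add: group_coarse_def)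

lemma coarse_structure_group_coarse:
  assumes "transitive_permutation_group X G"
  shows "coarse_structure X (group_coarse X G)"
proof -
  have perm: "g permutes X" if "g \<in> G" for g
    using assms that by (auto simp: transitive_permutation_group_def)
  have idG: "id \<in> G" and compG: "\<And>g h. g \<in> G \<Longrightarrow> h \<in> G \<Longrightarrow> g \<circ> h \<in> G"
    and invG: "\<And>g. g \<in> G \<Longrightarrow> inv g \<in> G"
    and trans: "\<And>x y. x \<in> X \<Longrightarrow> y \<in> X \<Longrightarrow> \<exists>g\<in>G. g x = y"
    using assms by (auto simp: transitive_permutation_group_def)
  have sub: "E \<subseteq> X \<times> X \<and> Id_on X \<subseteq> E" if "E \<in> group_coarse X G" for E
  proof (rule group_coarseE[OF that])
    fix F assume F: "F \<subseteq> G" "Id_on X \<subseteq> E" "E \<subseteq> {(x, g x) | x g. x \<in> X \<and> g \<in> F}"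
    have "g x \<in> X" if "x \<in> X" "g \<in> F" for x g
      using that perm F(1) permutes_in_image by (metis subsetD)
    then have "{(x, g x) | x g. x \<in> X \<and> g \<in> F} \<subseteq> X \<times> X" by auto
    then show ?thesis using F(2,3) by (meson order_trans)
  qed
  have comp: "E O E' \<in> group_coarse X G"
    if E: "E \<in> group_coarse X G" and E': "E' \<in> group_coarse X G" for E E'
  proof -
    obtain F where F: "finite F" "F \<subseteq> G" "id \<in> F" "Id_on X \<subseteq> E"
      "E \<subseteq> {(x, g x) | x g. x \<in> X \<and> g \<in> F}"
      using E by (rule group_coarseE)
    obtain F' where F': "finite F'" "F' \<subseteq> G" "id \<in> F'" "Id_on X \<subseteq> E'"
      "E' \<subseteq> {(x, g x) | x g. x \<in> X \<and> g \<in> F'}"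
      using E' by (rule group_coarseE)
    let ?H = "(\<lambda>(h, g). h \<circ> g) ` (F' \<times> F)"
    show ?thesis
    proof (rule group_coarseI[of ?H])
      show "finite ?H" using F(1) F'(1) by simp
      show "?H \<subseteq> G" using F(2) F'(2) compG by auto
      show "id \<in> ?H" using F(3) F'(3) by (auto intro!: image_eqI[of _ _ "(id, id)"])
      show "Id_on X \<subseteq> E O E'" using F(4) F'(4) by blast
      show "E O E' \<subseteq> {(x, g x) | x g. x \<in> X \<and> g \<in> ?H}"
      proof clarify
        fix x y z assume "(x, y) \<in> E" "(y, z) \<in> E'"
        then obtain g h where "x \<in> X" "g \<in> F" "y = g x" "h \<in> F'" "z = h y"
          using F(5) F'(5) by blast
        then show "\<exists>x' k. (x, z) = (x', k x') \<and> x' \<in> X \<and> k \<in> ?H"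
          by (intro exI[of _ x] exI[of _ "h \<circ> g"]) auto
      qed
    qed
  qed
  have conv: "E\<inverse> \<in> group_coarse X G" if E: "E \<in> group_coarse X G" for E
  proof -
    obtain F where F: "finite F" "F \<subseteq> G" "id \<in> F" "Id_on X \<subseteq> E"
      "E \<subseteq> {(x, g x) | x g. x \<in> X \<and> g \<in> F}"
      using E by (rule group_coarseE)
    show ?thesis
    proof (rule group_coarseI[of "inv ` F"])
      show "finite (inv ` F)" using F(1) by simp
      show "inv ` F \<subseteq> G" using F(2) invG by auto
      show "id \<in> inv ` F" using F(3) by (metis image_eqI inv_id)
      show "Id_on X \<subseteq> E\<inverse>" using F(4) by auto
      show "E\<inverse> \<subseteq> {(x, g x) | x g. x \<in> X \<and> g \<in> inv ` F}"
      proof clarify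
        fix x y assume "(y, x) \<in> E"
        then obtain g where g: "y \<in> X" "g \<in> F" "x = g y" using F(5) by blast
        then have "g permutes X" using F(2) perm by blast
        then have "inv g x = y" "x \<in> X"
          using g by (simp_all add: permutes_inverses permutes_in_image)
        then show "\<exists>x' k. (x, y) = (x', k x') \<and> x' \<in> X \<and> k \<in> inv ` F"
          using g(2) by blast
      qed
    qed
  qed
  have down: "E' \<in> group_coarse X G"
    if "E \<in> group_coarse X G" "Id_on X \<subseteq> E'" "E' \<subseteq> E" for E E'
    using that unfolding group_coarse_def by blast
  have "X \<times> X \<subseteq> \<Union>(group_coarse X G)"
  proof clarify
    fix x y assume "x \<in> X" "y \<in> X"
    then obtain g where g: "g \<in> G" "g x = y" using trans by blast
    let ?E = "{(x, h x) | x h. x \<in> X \<and> h \<in> {id, g}}"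
    have "?E \<in> group_coarse X G"
      by (rule group_coarseI[of "{id, g}"]) (use g idG in force)+
    moreover have "(x, y) \<in> ?E" using g \<open>x \<in> X\<close> by blast
    ultimately show "(x, y) \<in> \<Union>(group_coarse X G)" by blast
  qed
  moreover have "\<Union>(group_coarse X G) \<subseteq> X \<times> X"
    by (rule Union_least) (rule sub[THEN conjunct1])
  ultimately have union: "\<Union>(group_coarse X G) = X \<times> X"
    by (rule subset_antisym[rotated])
  show ?thesis
    unfolding coarse_structure_def
  proof (intro conjI ballI allI impI)
    fix E E' assume "E \<in> group_coarse X G" "Id_on X \<subseteq> E' \<and> E' \<subseteq> E"
    then show "E' \<in> group_coarse X G" using down by blast
  qed (fact sub[THEN conjunct1] sub[THEN conjunct2] comp conv union)+
qed

lemma transitive_perms_below: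
  fixes X :: "'a set" and \<kappa> :: "'k rel"
  assumes "Cinfinite \<kappa>"
  shows "transitive_permutation_group X (perms_below X \<kappa>)"
proof -
  have fin: "|A| <o \<kappa>" if "finite A" for A :: "'a set"
    by (rule finite_ordLess_infinite)
      (use that assms in \<open>auto simp: cinfinite_def Field_card_of
         intro: card_order_on_well_order_on card_of_card_order_on card_of_well_order_on\<close>)
  have comp: "g \<circ> h \<in> perms_below X \<kappa>" if "g \<in> perms_below X \<kappa>" "h \<in> perms_below X \<kappa>" for g h
  proof -
    have "supp X (g \<circ> h) \<subseteq> supp X g \<union> supp X h"
      unfolding supp_def by auto
    moreover have "|supp X g \<union> supp X h| <o \<kappa>"
      using that assms unfolding perms_below_def cinfinite_def
      by (intro card_of_Un_ordLess_infinite_Field) auto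
    ultimately have "|supp X (g \<circ> h)| <o \<kappa>"
      by (meson card_of_mono1 ordLeq_ordLess_trans)
    then show ?thesis
      using that by (simp add: perms_below_def permutes_compose)
  qed
  have inv: "inv g \<in> perms_below X \<kappa>" if "g \<in> perms_below X \<kappa>" for g
  proof -
    have "g permutes X" using that by (simp add: perms_below_def)
    then have "supp X (inv g) = supp X g"
      unfolding supp_def by (metis permutes_inv_eq)
    then show ?thesis
      using that by (simp add: perms_below_def permutes_inv)
  qed
  have trans: "\<exists>g\<in>perms_below X \<kappa>. g x = y" if "x \<in> X" "y \<in> X" for x y
  proof
    have "supp X (transpose x y) \<subseteq> {x, y}"
      unfolding supp_def by (auto simp: transpose_def)
    then have "finite (supp X (transpose x y))"
      by (rule finite_subset) simp
    then show "transpose x y \<in> perms_below X \<kappa>"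
      using that fin by (simp add: perms_below_def permutes_swap_id)
  qed simp
  have "id \<in> perms_below X \<kappa>"
    using fin[of "supp X id"] by (simp add: perms_below_def permutes_id supp_def)
  then show ?thesis
    unfolding transitive_permutation_group_def
    using comp inv trans by (auto simp: perms_below_def)
qed

end

theory Submission
  imports Defs
begin

text \<open>Let \<open>\<kappa>\<close> be the least cardinal exceeding the number of off-diagonal pairs of every entourage.
  Off the diagonal, a symmetric entourage \<open>S\<close> is a finite union of matchings: \<open>S O S\<close> has bounded
  degree, so its vertices can be coloured with finitely many colours, and the edges of \<open>S\<close> between
  two given colour classes form a matching. Each matching is traced by an involution of support
  smaller than \<open>\<kappa>\<close>, so \<open>\<E>\<close> is contained in the structure of \<open>\<S>\<^sub>X\<^sup><\<^sup>\<kappa>\<close>. Conversely, the graph of a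
  permutation in \<open>\<S>\<^sub>X\<^sup><\<^sup>\<kappa>\<close> is also a finite union of matchings, and each of these is no larger
  than some matching in \<open>\<E>\<close>, onto which it can be moved by permutations of \<open>X\<close>; invariance puts
  it in \<open>\<E>\<close>.\<close>

section \<open>Bounded degree relations as finite unions of matchings\<close>

text \<open>Greedy colouring along a well-order of the type: the neighbours of a point use at most
  \<open>n\<close> of the \<open>n + 1\<close> colours, so one is left. Of two distinct adjacent
  points, the later one avoids the colour of the earlier.\<close>

lemma bounded_degree_colouring:
  fixes R :: "'a rel"
  assumes sym: "sym R" and deg: "\<And>x. finite (R `` {x}) \<and> card (R `` {x}) \<le> n"
  shows "\<exists>c :: 'a \<Rightarrow> nat. (\<forall>x. c x \<le> n) \<and> (\<forall>x y. (x, y) \<in> R \<longrightarrow> x \<noteq> y \<longrightarrow> c x \<noteq> c y)"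
proof -
  obtain r :: "'a rel" where r: "Well_order r" "Field r = UNIV"
    using well_ordering[where 'a = 'a] by (elim exE conjE)
  define W where "W = r - Id"
  have "wf W" using r by (simp add: W_def well_order_on_def)
  have total: "(x, y) \<in> W \<or> (y, x) \<in> W" if "x \<noteq> y" for x y
    using that r by (auto simp: W_def well_order_on_def linear_order_on_def total_on_def)
  \<comment> \<open>\<open>P f x k\<close> consults \<open>f\<close> only at
    \<open>W\<close>-predecessors of \<open>x\<close>, as well-founded choice requires.\<close>
  define P where
    "P f x k \<longleftrightarrow> k \<le> n \<and> (\<forall>y. (y, x) \<in> W \<longrightarrow> (x, y) \<in> R \<longrightarrow> f y \<noteq> k)" for f :: "'a \<Rightarrow> nat" and x k
  have "\<exists>c. \<forall>x. P c x (c x)"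
  proof (rule dependent_wf_choice[OF \<open>wf W\<close>])
    fix f g :: "'a \<Rightarrow> nat" and x k
    assume "\<And>z. (z, x) \<in> W \<Longrightarrow> f z = g z"
    then show "P f x k = P g x k" unfolding P_def by metis
  next
    fix x :: 'a and f :: "'a \<Rightarrow> nat"
    \<comment> \<open>All neighbours are avoided here, earlier or not; \<open>n\<close> values
      cannot exhaust \<open>{..n}\<close>.\<close>
    have "card (f ` (R `` {x})) \<le> n"
      using deg[of x] card_image_le[of "R `` {x}" f] by linarith
    moreover have "finite (f ` (R `` {x}))" using deg[of x] by simp
    ultimately have "\<not> {..n} \<subseteq> f ` (R `` {x})"
      using card_mono[of "f ` (R `` {x})" "{..n}"] by (metis card_atMost le_trans not_less_eq_eq)
    then obtain k where "k \<le> n" "k \<notin> f ` (R `` {x})" by blast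
    then have "P f x k" unfolding P_def by blast
    then show "\<exists>k. P f x k" ..
  qed
  then obtain c where c: "\<And>x. P c x (c x)" by blast
  have "c x \<noteq> c y" if "(x, y) \<in> R" "x \<noteq> y" for x y
    using total[OF that(2)] c[of x] c[of y] that(1) symD[OF sym that(1)] unfolding P_def by metis
  moreover have "c x \<le> n" for x using c[of x] by (simp add: P_def)
  ultimately show ?thesis by blast
qed

text \<open>Edges are oriented. Disjointness of \<open>Domain M\<close> and \<open>Range M\<close>
  excludes loops, paths and cycles, which the two single-valuedness conditions alone would allow, so
  distinct edges share no vertex.\<close>

definition matching :: "'a rel \<Rightarrow> bool" where
  "matching M \<longleftrightarrow> single_valued M \<and> single_valued (M\<inverse>) \<and> Domain M \<inter> Range M = {}"

lemma matching_left_unique: "matching M \<Longrightarrow> (x, y) \<in> M \<Longrightarrow> (x', y) \<in> M \<Longrightarrow> x = x'"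
  and matching_right_unique: "matching M \<Longrightarrow> (x, y) \<in> M \<Longrightarrow> (x, y') \<in> M \<Longrightarrow> y = y'"
  and matching_disjoint: "matching M \<Longrightarrow> (x, y) \<in> M \<Longrightarrow> (y, z) \<notin> M"
  unfolding matching_def single_valued_def by blast+

lemma matching_subset: "matching M \<Longrightarrow> N \<subseteq> M \<Longrightarrow> matching N"
  unfolding matching_def single_valued_def by blast

text \<open>In a proper colouring of \<open>S O S\<close>, distinct points of equal colour have no
  common neighbour in \<open>S\<close>. Hence a point has at most one neighbour of each
  colour.\<close>

lemma matching_cover:
  assumes sym: "sym S" and refl: "Id_on X \<subseteq> S" and sub: "S \<subseteq> X \<times> X"
    and deg: "\<And>x. x \<in> X \<Longrightarrow> finite ((S O S) `` {x}) \<and> card ((S O S) `` {x}) \<le> n"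
  obtains \<M> where "finite \<M>" "\<And>M. M \<in> \<M> \<Longrightarrow> matching M" "S - Id = \<Union>\<M>"
proof -
  have "finite ((S O S) `` {x}) \<and> card ((S O S) `` {x}) \<le> n" for x
  proof (cases "x \<in> X")
    case False
    then have "(S O S) `` {x} = {}" using sub by blast
    then show ?thesis by simp
  qed (rule deg)
  moreover have "sym (S O S)" using sym by (auto simp: sym_def)
  ultimately obtain c :: "'a \<Rightarrow> nat" where cn: "\<And>x. c x \<le> n"
    and c: "\<And>x y. (x, y) \<in> S O S \<Longrightarrow> x \<noteq> y \<Longrightarrow> c x \<noteq> c y"
    using bounded_degree_colouring[of "S O S" n] by blast
  \<comment> \<open>By reflexivity on \<open>X\<close>, every pair of \<open>S\<close> also lies in
    \<open>S O S\<close>.\<close>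
  have c1: "c x \<noteq> c y" if "(x, y) \<in> S" "x \<noteq> y" for x y
  proof -
    have "(y, y) \<in> S" using that(1) sub refl by auto
    then show ?thesis using that c[of x y] by blast
  qed
  have c2: "y = z" if "(x, y) \<in> S" "(x, z) \<in> S" "c y = c z" for x y z
    using that c[of y z] sym by (meson relcomp.relcompI symD)
  define M where "M i j = {(x, y) \<in> S. c x = i \<and> c y = j}" for i j
  show ?thesis
  proof (rule that[of "(\<lambda>(i, j). M i j) ` {(i, j). i \<le> n \<and> j \<le> n \<and> i \<noteq> j}"])
    have "{(i, j). i \<le> n \<and> j \<le> n \<and> i \<noteq> j} \<subseteq> {..n} \<times> {..n}" by auto
    then show "finite ((\<lambda>(i, j). M i j) ` {(i, j). i \<le> n \<and> j \<le> n \<and> i \<noteq> j})"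
      using finite_subset by blast
  next
    fix N assume "N \<in> (\<lambda>(i, j). M i j) ` {(i, j). i \<le> n \<and> j \<le> n \<and> i \<noteq> j}"
    then obtain i j where N: "N = M i j" "i \<noteq> j" by auto
    have "y = z" if "(x, y) \<in> N" "(x, z) \<in> N" for x y z
      using that c2[of x y z] by (auto simp: N M_def)
    moreover have "y = z" if "(y, x) \<in> N" "(z, x) \<in> N" for x y z
      using that c2[of x y z] symD[OF sym, of y x] symD[OF sym, of z x] by (auto simp: N M_def)
    moreover have "Domain N \<inter> Range N = {}"
      using N(2) by (auto simp: N(1) M_def)
    ultimately show "matching N"
      unfolding matching_def single_valued_def by blast
  next
    show "S - Id = \<Union> ((\<lambda>(i, j). M i j) ` {(i, j). i \<le> n \<and> j \<le> n \<and> i \<noteq> j})"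
    proof (intro subset_antisym subrelI)
      fix x y assume xy: "(x, y) \<in> S - Id"
      then have "(x, y) \<in> M (c x) (c y)" "c x \<noteq> c y" using c1[of x y] by (auto simp: M_def)
      then show "(x, y) \<in> \<Union> ((\<lambda>(i, j). M i j) ` {(i, j). i \<le> n \<and> j \<le> n \<and> i \<noteq> j})"
        using cn by (intro UnionI[of "M (c x) (c y)"] image_eqI[of _ _ "(c x, c y)"]) simp_all
    next
      fix x y assume "(x, y) \<in> \<Union> ((\<lambda>(i, j). M i j) ` {(i, j). i \<le> n \<and> j \<le> n \<and> i \<noteq> j})"
      then obtain i j where "i \<noteq> j" "(x, y) \<in> M i j" by auto
      then show "(x, y) \<in> S - Id" by (auto simp: M_def)
    qed
  qed
qed

text \<open>In a matching, a vertex of the field has exactly one partner, so \<open>THE\<close> is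
  well defined and the map is the involution exchanging the ends of every edge.\<close>

definition swap_along :: "'a rel \<Rightarrow> 'a \<Rightarrow> 'a" where
  "swap_along M x = (if x \<in> Field M then THE y. (x, y) \<in> M \<or> (y, x) \<in> M else x)"

lemma swap_along:
  assumes "matching M"
  shows "(x, y) \<in> M \<Longrightarrow> swap_along M x = y" and "(x, y) \<in> M \<Longrightarrow> swap_along M y = x"
    and "x \<notin> Field M \<Longrightarrow> swap_along M x = x"
proof -
  assume xy: "(x, y) \<in> M"
  have "(THE z. (x, z) \<in> M \<or> (z, x) \<in> M) = y"
    using xy assms by (intro the_equality) (auto simp: matching_def single_valued_def)
  then show "swap_along M x = y" using xy by (simp add: swap_along_def Field_def Domain.DomainI)
  have "(THE z. (y, z) \<in> M \<or> (z, y) \<in> M) = x"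
    using xy assms by (intro the_equality) (auto simp: matching_def single_valued_def)
  then show "swap_along M y = x" using xy by (simp add: swap_along_def Field_def Range.RangeI)
qed (simp add: swap_along_def)

lemma swap_along_permutes:
  assumes "matching M" "M \<subseteq> X \<times> X"
  shows "swap_along M permutes X"
proof -
  have "swap_along M (swap_along M x) = x" for x
    using swap_along[OF assms(1)] by (cases "x \<in> Field M") (auto simp: Field_def)
  moreover have "swap_along M x = x" if "x \<notin> X" for x
    using that assms by (intro swap_along(3)) (auto simp: Field_def)
  ultimately show ?thesis unfolding permutes_def by metis
qed

section \<open>Moving matchings by permutations\<close>

lemma finite_Union_ordLess:
  assumes "Cinfinite r" "finite \<A>" "\<And>A. A \<in> \<A> \<Longrightarrow> |A| <o r"
  shows "|\<Union>\<A>| <o r"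
  using assms(2,3)
proof (induction \<A> rule: finite_induct)
  case empty
  show ?case using assms(1) by (simp add: Cinfinite_gt_empty)
next
  case (insert A \<A>)
  then show ?case
    using assms(1) card_of_Un_ordLess_infinite_Field[of r A "\<Union>\<A>"]
    by (simp add: cinfinite_def)
qed

lemma card_of_inj_image: "inj_on f A \<Longrightarrow> |f ` A| =o |A|"
  by (rule ordIso_symmetric, rule card_of_ordIsoI, rule inj_on_imp_bij_betw)

lemma card_of_matching_parts:
  assumes "matching M"
  shows "|Domain M| =o |M|" "|Field M| \<le>o |M| +c |M|"
proof -
  have "inj_on fst M" using assms by (auto simp: matching_def single_valued_def inj_on_def)
  then show "|Domain M| =o |M|"
    unfolding fst_eq_Domain[symmetric]
    by (rule card_of_inj_image)
  have "|Domain M \<union> Range M| \<le>o |Domain M| +c |Range M|" by (rule Un_csum)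
  moreover have "|Domain M| +c |Range M| \<le>o |M| +c |M|"
    unfolding fst_eq_Domain[symmetric] snd_eq_Range[symmetric]
    by (intro csum_mono card_of_image)
  ultimately show "|Field M| \<le>o |M| +c |M|"
    unfolding Field_def using ordLeq_transitive by blast
qed

lemma card_of_Field_matching:
  assumes "matching M" "infinite M"
  shows "|Field M| \<le>o |M|"
proof -
  have "|M| +c |M| =o |M|"
    using card_of_Plus_infinite1[OF assms(2) card_of_mono1[OF subset_refl]]
    by (simp add: csum_def Field_card_of)
  then show ?thesis using card_of_matching_parts(2)[OF assms(1)] ordLeq_ordIso_trans by blast
qed

lemma infinite_split:
  assumes "infinite A"
  obtains B C where "A = B \<union> C" "B \<inter> C = {}" "|B| =o |A|" "|C| =o |A|"
proof -
  have "|A <+> A| =o |A|" using card_of_Plus_infinite1[OF assms card_of_mono1[OF subset_refl]] .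
  then obtain f where f: "bij_betw f (A <+> A) A" using card_of_ordIso by blast
  then have inj: "inj_on f (A <+> A)" by (rule bij_betw_imp_inj_on)
  show ?thesis
  proof (rule that[of "f ` Inl ` A" "f ` Inr ` A"])
    show "A = f ` Inl ` A \<union> f ` Inr ` A"
      using f by (auto simp: bij_betw_def Plus_def image_Un)
    show "f ` Inl ` A \<inter> f ` Inr ` A = {}"
      using inj by (auto simp: inj_on_def)
    have "inj_on (f \<circ> Inl) A" "inj_on (f \<circ> Inr) A"
      using inj by (auto simp: inj_on_def)
    then show "|f ` Inl ` A| =o |A|" "|f ` Inr ` A| =o |A|"
      unfolding image_comp by (simp_all only: card_of_inj_image)
  qed
qed

text \<open>The complement is infinite and at least as large as \<open>P\<close>, so adjoining
  \<open>P\<close> to it does not change its cardinality.\<close>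

lemma card_of_Diff_large:
  assumes "infinite X" "P \<subseteq> X" "|P| \<le>o |X - P|"
  shows "|X - P| =o |X|"
proof -
  have "infinite (X - P)"
  proof
    assume "finite (X - P)"
    moreover from this have "finite P" using assms(3) card_of_ordLeq_finite by blast
    ultimately show False using assms(1,2) by (metis finite_Diff2)
  qed
  then have "|(X - P) \<union> P| \<le>o |X - P|"
    using card_of_Un_Plus_ordLeq card_of_Plus_infinite1[OF _ assms(3)] ordLeq_ordIso_trans by blast
  moreover have "(X - P) \<union> P = X" using assms(2) by blast
  ultimately show ?thesis by (simp add: ordIso_iff_ordLeq card_of_mono1)
qed

text \<open>A bijection between the fields of two matchings extends to a permutation of \<open>X\<close> only if the
  complements are equipollent, which halving the matchings guarantees.\<close>

lemma matching_split:
  assumes "matching M" "M \<subseteq> X \<times> X" "infinite M" "infinite X"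
  obtains M1 M2 where "M = M1 \<union> M2" "|M1| =o |M|" "|M2| =o |M|"
    "|X - Field M1| =o |X|" "|X - Field M2| =o |X|"
proof -
  obtain M1 M2 where split: "M = M1 \<union> M2" "M1 \<inter> M2 = {}" "|M1| =o |M|" "|M2| =o |M|"
    using infinite_split[OF assms(3)] by metis
  \<comment> \<open>The sources of the edges of one half are missed by the field of the other half,
    so the complement of that field is large enough.\<close>
  have half: "|X - Field A| =o |X|"
    if A: "A \<subseteq> M" "B \<subseteq> M" "A \<inter> B = {}" "|A| =o |M|" "|B| =o |M|" for A B
  proof (rule card_of_Diff_large[OF assms(4)])
    show "Field A \<subseteq> X" using A assms(2) by (auto simp: Field_def)
    have "infinite A" using A(4) assms(3) card_of_ordIso_finite by blast
    then have "|Field A| \<le>o |A|" using card_of_Field_matching matching_subset assms(1) A(1) by blast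
    also have "|A| =o |B|" using A(4,5) ordIso_symmetric ordIso_transitive by blast
    also have "|B| =o |Domain B|"
      using card_of_matching_parts(1) matching_subset assms(1) A(2) ordIso_symmetric by blast
    also have "|Domain B| \<le>o |X - Field A|"
    proof (rule card_of_mono1, rule subsetI, elim DomainE)
      fix x y assume xy: "(x, y) \<in> B"
      have "x \<notin> Field A"
      proof
        assume "x \<in> Field A"
        then obtain z where "(x, z) \<in> A \<or> (z, x) \<in> A" by (auto simp: Field_def)
        then consider "(x, z) \<in> A" | "(z, x) \<in> A" by blast
        then show False
        proof cases
          case 1
          then have "z = y" using matching_right_unique[OF assms(1)] xy A(1,2) by blast
          then show False using 1 xy A(3) by blast
        next
          case 2
          then show False using matching_disjoint[OF assms(1)] xy A(1,2) by blast
        qed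
      qed
      then show "x \<in> X - Field A" using xy A(2) assms(2) by blast
    qed
    finally show "|Field A| \<le>o |X - Field A|" .
  qed
  show ?thesis
    using that split half[of M1 M2] half[of M2 M1] by blast
qed

text \<open>A vertex is coded by its unique edge and a bit, \<open>True\<close> for the source and
  \<open>False\<close> for the target. Maps of edges thereby induce maps of vertices that respect
  orientation.\<close>

lemma matching_bij_Field:
  assumes "matching M"
  shows "bij_betw (\<lambda>(p, b). if b then fst p else snd p) (M \<times> (UNIV :: bool set)) (Field M)"
    (is "bij_betw ?e _ _")
proof (rule bij_betw_imageI)
  have inj: "u = v" if uv: "fst u \<in> M" "fst v \<in> M" "?e u = ?e v" for u v
  proof -
    obtain a b p c d q where uv': "u = ((a, b), p)" "v = ((c, d), q)" by (metis prod.collapse)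
    have M: "(a, b) \<in> M" "(c, d) \<in> M" using uv by (simp_all add: uv')
    show ?thesis
    proof (cases p; cases q)
      assume "p" "q"
      then show ?thesis using uv(3) matching_right_unique[OF assms M(1), of d] M(2) by (simp add: uv')
    next
      assume "p" "\<not> q"
      then show ?thesis using uv(3) matching_disjoint[OF assms M(2), of b] M(1) by (simp add: uv')
    next
      assume "\<not> p" "q"
      then show ?thesis using uv(3) matching_disjoint[OF assms M(1), of d] M(2) by (simp add: uv')
    next
      assume "\<not> p" "\<not> q"
      then show ?thesis using uv(3) matching_left_unique[OF assms M(1), of c] M(2) by (simp add: uv')
    qed
  qed
  show "inj_on ?e (M \<times> (UNIV :: bool set))"
    by (rule inj_onI, rule inj) (simp_all add: mem_Times_iff)
  have "M \<times> (UNIV :: bool set) = (\<lambda>p. (p, True)) ` M \<union> (\<lambda>p. (p, False)) ` M"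
    unfolding UNIV_bool by blast
  then show "?e ` (M \<times> (UNIV :: bool set)) = Field M"
    by (simp add: image_Un image_image fst_eq_Domain snd_eq_Range Field_def)
qed

text \<open>An injection of \<open>N\<close> into \<open>M\<close> identifies \<open>N\<close> with
  a submatching of \<open>M\<close>, edge by edge and hence vertex by vertex. The vertex map extends
  to all of \<open>X\<close> because both complements have the size of \<open>X\<close>.\<close>

lemma matching_transport:
  assumes M: "matching M" "M \<subseteq> X \<times> X" "|X - Field M| =o |X|"
    and N: "matching N" "N \<subseteq> X \<times> X" "|X - Field N| =o |X|"
    and le: "|N| \<le>o |M|"
  shows "\<exists>f. f permutes X \<and> N \<subseteq> map_prod f f ` M"
proof -
  obtain m where m: "inj_on m N" "m ` N \<subseteq> M" using le card_of_ordLeq[of N M] by blast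
  define M' where "M' = m ` N"
  have M': "matching M'" "M' \<subseteq> M" using matching_subset[OF M(1)] m(2) by (auto simp: M'_def)
  let ?e = "\<lambda>(p :: 'a \<times> 'a, b). if b then fst p else snd p"
  have mN: "bij_betw m N M'" using m(1) by (simp add: M'_def bij_betw_def)
  \<comment> \<open>Decode a vertex of \<open>M'\<close> as an edge with a chosen end, pull the edge
    back along \<open>m\<close>, and read off the same end in \<open>N\<close>.\<close>
  define f0 where "f0 = ?e \<circ> map_prod (inv_into N m) (id :: bool \<Rightarrow> bool)
      \<circ> inv_into (M' \<times> (UNIV :: bool set)) ?e"
  have bijM': "bij_betw ?e (M' \<times> (UNIV :: bool set)) (Field M')"
    using matching_bij_Field[OF M'(1)] .
  have "bij_betw (map_prod (inv_into N m) (id :: bool \<Rightarrow> bool)) (M' \<times> UNIV) (N \<times> UNIV)"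
    using bij_betw_inv_into[OF mN] bij_betw_map_prod bij_betw_id by blast
  then have f0: "bij_betw f0 (Field M') (Field N)"
    unfolding f0_def
    using bij_betw_trans[OF bij_betw_trans[OF bij_betw_inv_into[OF bijM']]
        matching_bij_Field[OF N(1)]] by (simp add: comp_assoc)
  have f0N: "f0 (fst (m p)) = fst p \<and> f0 (snd (m p)) = snd p" if "p \<in> N" for p
  proof -
    have "m p \<in> M'" using that by (simp add: M'_def)
    then have "inv_into (M' \<times> UNIV) ?e (?e (m p, b)) = (m p, b)" for b :: bool
      using bij_betw_inv_into_left[OF bijM'] by blast
    from this[of True] this[of False] show ?thesis
      using inv_into_f_f[OF m(1) that] by (simp add: f0_def)
  qed
  \<comment> \<open>Passing from \<open>M\<close> to the smaller \<open>M'\<close> only enlarges the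
    complement of the field.\<close>
  have "|X| \<le>o |X - Field M'|"
    using M(3) M'(2) card_of_mono1[of "X - Field M" "X - Field M'"]
    by (meson Diff_mono mono_Field monoD ordIso_ordLeq_trans ordIso_symmetric order_refl)
  then have "|X - Field M'| =o |X|"
    by (simp add: ordIso_iff_ordLeq card_of_mono1)
  then have "|X - Field M'| =o |X - Field N|"
    using N(3) ordIso_symmetric ordIso_transitive by blast
  then obtain f1 where f1: "bij_betw f1 (X - Field M') (X - Field N)" using card_of_ordIso by blast
  define f where "f x = (if x \<in> X then if x \<in> Field M' then f0 x else f1 x else x)" for x
  have FM: "Field M' \<subseteq> X" "Field N \<subseteq> X" using M(2) M'(2) N(2) by (auto simp: Field_def)
  have "bij_betw f (Field M') (Field N)"
    using f0 by (rule bij_betw_cong[THEN iffD1, rotated]) (use FM in \<open>auto simp: f_def\<close>)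
  moreover have "bij_betw f (X - Field M') (X - Field N)"
    using f1 by (rule bij_betw_cong[THEN iffD1, rotated]) (auto simp: f_def)
  ultimately have "bij_betw f (Field M' \<union> (X - Field M')) (Field N \<union> (X - Field N))"
    by (rule bij_betw_combine) auto
  then have "bij_betw f X X" using FM by (simp add: Un_absorb1)
  then have "f permutes X" by (rule bij_imp_permutes) (simp add: f_def)
  moreover have "p \<in> map_prod f f ` M" if "p \<in> N" for p
  proof
    have mp: "m p \<in> M'" using that by (simp add: M'_def)
    then show "m p \<in> M" using M'(2) by blast
    have "fst (m p) \<in> Field M'" "snd (m p) \<in> Field M'"
      using mp by (auto simp: Field_def fst_eq_Domain[symmetric] snd_eq_Range[symmetric])
    then have "f (fst (m p)) = fst p" "f (snd (m p)) = snd p"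
      using f0N[OF that] FM(1) by (auto simp: f_def)
    then show "p = map_prod f f (m p)" by (simp add: prod_eq_iff)
  qed
  ultimately show ?thesis by blast
qed

section \<open>Coarse structures invariant under all permutations\<close>

locale coarse =
  fixes X :: "'a set" and \<E> :: "'a rel set"
  assumes coarse: "coarse_structure X \<E>" and inf_X: "infinite X"
begin

lemmas coarse_conds = coarse[unfolded coarse_structure_def]

lemma ent_sub: "E \<in> \<E> \<Longrightarrow> E \<subseteq> X \<times> X" and ent_refl: "E \<in> \<E> \<Longrightarrow> Id_on X \<subseteq> E"
  using coarse_conds[THEN conjunct1] by blast+

lemma ent_comp: "E \<in> \<E> \<Longrightarrow> E' \<in> \<E> \<Longrightarrow> E O E' \<in> \<E>"
  using coarse_conds[THEN conjunct2, THEN conjunct1] by blast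

lemma ent_conv: "E \<in> \<E> \<Longrightarrow> E\<inverse> \<in> \<E>"
  using coarse_conds[THEN conjunct2, THEN conjunct2, THEN conjunct1] by blast

lemma ent_down: "E \<in> \<E> \<Longrightarrow> Id_on X \<subseteq> E' \<Longrightarrow> E' \<subseteq> E \<Longrightarrow> E' \<in> \<E>"
  using coarse_conds[THEN conjunct2, THEN conjunct2, THEN conjunct2, THEN conjunct1] by metis

lemma ent_Union: "\<Union>\<E> = X \<times> X"
  using coarse_conds by (elim conjE)

text \<open>Adding the diagonal turns any part of an entourage into an entourage. From here on,
  \<open>D \<union> Id_on X \<in> \<E>\<close> expresses that the relation \<open>D\<close> is
  controlled.\<close>

lemma ent_subset: "E \<in> \<E> \<Longrightarrow> D \<subseteq> E \<Longrightarrow> D \<union> Id_on X \<in> \<E>"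
  by (rule ent_down[of E]) (use ent_refl[of E] in simp_all)

text \<open>Unions are not among the axioms, but a composition contains both of its factors since
  each contains the diagonal.\<close>

lemma ent_Un:
  assumes "D \<union> Id_on X \<in> \<E>" "D' \<union> Id_on X \<in> \<E>"
  shows "(D \<union> D') \<union> Id_on X \<in> \<E>"
proof (rule ent_subset)
  show "(D \<union> Id_on X) O (D' \<union> Id_on X) \<in> \<E>" using assms by (rule ent_comp)
  show "D \<union> D' \<subseteq> (D \<union> Id_on X) O (D' \<union> Id_on X)"
  proof (rule subrelI)
    fix x y assume xy: "(x, y) \<in> D \<union> D'"
    then have "(x, x) \<in> Id_on X" "(y, y) \<in> Id_on X" using assms[THEN ent_sub] by auto
    then show "(x, y) \<in> (D \<union> Id_on X) O (D' \<union> Id_on X)"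
      using xy by (metis UnE UnI1 UnI2 relcomp.relcompI)
  qed
qed

lemma ent_finite_Union:
  assumes "finite \<D>" "\<And>D. D \<in> \<D> \<Longrightarrow> D \<union> Id_on X \<in> \<E>"
  shows "\<Union>\<D> \<union> Id_on X \<in> \<E>"
  using assms
proof (induction \<D> rule: finite_induct)
  \<comment> \<open>The axiom on \<open>\<Union>\<E>\<close> yields some entourage because
    \<open>X\<close> is nonempty; the diagonal is then one too.\<close>
  case empty
  obtain x where "x \<in> X" using inf_X by fastforce
  then obtain E where "E \<in> \<E>" using ent_Union by (metis UnionE mem_Sigma_iff)
  then show ?case using ent_subset[of E "{}"] by simp
next
  case (insert D \<D>)
  then show ?case using ent_Un[of D "\<Union>\<D>"] by simp
qed

lemma ent_finite:
  assumes "finite D" "D \<subseteq> X \<times> X"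
  shows "D \<union> Id_on X \<in> \<E>"
proof -
  have "{p} \<union> Id_on X \<in> \<E>" if "p \<in> D" for p
  proof -
    have "p \<in> \<Union>\<E>" using assms(2) that unfolding ent_Union by (rule subsetD)
    then obtain E where "E \<in> \<E>" "p \<in> E" by (rule UnionE)
    then show ?thesis by (intro ent_subset[of E "{p}"]) simp_all
  qed
  then have "\<Union>((\<lambda>p. {p}) ` D) \<union> Id_on X \<in> \<E>"
    using assms(1) by (intro ent_finite_Union) auto
  then show ?thesis by simp
qed

lemma ent_symmetrize:
  assumes "E \<in> \<E>"
  shows "E O E\<inverse> \<in> \<E>" "sym (E O E\<inverse>)" "E \<subseteq> E O E\<inverse>"
proof -
  show "E O E\<inverse> \<in> \<E>" by (intro ent_comp ent_conv assms)
  show "sym (E O E\<inverse>)" by (simp add: sym_conv_converse_eq converse_relcomp)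
  show "E \<subseteq> E O E\<inverse>"
  proof (rule subrelI)
    fix x y assume xy: "(x, y) \<in> E"
    then have "y \<in> X" using ent_sub[OF assms] by auto
    then have "(y, y) \<in> E" using ent_refl[OF assms] by auto
    then show "(x, y) \<in> E O E\<inverse>" using xy by auto
  qed
qed

end

section \<open>Controlled matchings and graphs under invariance\<close>

locale invariant_coarse = coarse +
  assumes finitary: "finitary X \<E>"
    and invariant: "\<And>f. f permutes X \<Longrightarrow> asymorphism X \<E> X \<E> f"
begin

lemma ent_matching_cover:
  assumes "S \<in> \<E>" "sym S"
  obtains \<M> where "finite \<M>" "\<And>M. M \<in> \<M> \<Longrightarrow> matching M" "S - Id = \<Union>\<M>"
proof -
  have "S O S \<in> \<E>" using assms(1) assms(1) by (rule ent_comp)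
  then obtain n where "\<forall>x\<in>X. finite ((S O S) `` {x}) \<and> card ((S O S) `` {x}) < n"
    using finitary unfolding finitary_def by (elim ballE) auto
  then have deg: "finite ((S O S) `` {x}) \<and> card ((S O S) `` {x}) \<le> n" if "x \<in> X" for x
    using that less_imp_le by metis
  show ?thesis
    by (rule matching_cover[OF assms(2) ent_refl[OF assms(1)] ent_sub[OF assms(1)] deg]) (assumption, rule that)
qed

lemma ent_transport:
  assumes "M \<union> Id_on X \<in> \<E>" "f permutes X" "N \<subseteq> map_prod f f ` M"
  shows "N \<union> Id_on X \<in> \<E>"
proof -
  obtain E where E: "E \<in> \<E>" "\<And>x y. x \<in> X \<Longrightarrow> y \<in> X \<Longrightarrow> (x, y) \<in> M \<union> Id_on X \<Longrightarrow> (f x, f y) \<in> E"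
    using invariant[OF assms(2)] assms(1) unfolding asymorphism_def macro_uniform_def by meson
  have "M \<subseteq> X \<times> X" using ent_sub[OF assms(1)] by blast
  then have "map_prod f f ` M \<subseteq> E" using E(2) by auto
  then show ?thesis using ent_subset[OF E(1)] assms(3) by blast
qed

text \<open>Finite relations are always controlled. Otherwise both matchings are halved to obtain
  large complements, and one half of \<open>M\<close> is moved onto each half of \<open>N\<close> in
  turn.\<close>

lemma ent_matching_le:
  assumes M: "matching M" "M \<union> Id_on X \<in> \<E>" and N: "matching N" "N \<subseteq> X \<times> X"
    and le: "|N| \<le>o |M|"
  shows "N \<union> Id_on X \<in> \<E>"
proof (cases "finite N")
  case True
  then show ?thesis using ent_finite N(2) by blast
next
  case False
  then have infM: "infinite M" using le card_of_ordLeq_finite by blast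
  have subM: "M \<subseteq> X \<times> X" using ent_sub[OF M(2)] by blast
  obtain M1 M2 where M12: "M = M1 \<union> M2" "|M1| =o |M|" "|X - Field M1| =o |X|"
    using matching_split[OF M(1) subM infM inf_X] by metis
  have M1: "matching M1" "M1 \<subseteq> X \<times> X" "M1 \<union> Id_on X \<in> \<E>"
    using M12(1) subM matching_subset[OF M(1)] ent_subset[OF M(2), of M1] by auto
  obtain N1 N2 where N12: "N = N1 \<union> N2" "|N1| =o |N|" "|N2| =o |N|"
      "|X - Field N1| =o |X|" "|X - Field N2| =o |X|"
    using matching_split[OF N False inf_X] by metis
  have part: "K \<union> Id_on X \<in> \<E>" if K: "K \<subseteq> N" "|K| =o |N|" "|X - Field K| =o |X|" for K
  proof -
    have "|K| \<le>o |M1|"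
      using K(2) le M12(2) ordIso_ordLeq_trans ordIso_symmetric ordLeq_ordIso_trans by blast
    moreover have "matching K" "K \<subseteq> X \<times> X" using K(1) N matching_subset by auto
    ultimately obtain f where "f permutes X" "K \<subseteq> map_prod f f ` M1"
      using matching_transport[OF M1(1,2) M12(3)] K(3) by blast
    then show ?thesis using ent_transport M1(3) by blast
  qed
  then show ?thesis using ent_Un[of N1 N2] N12 by simp
qed

lemma ent_matching_le_ent:
  assumes "E \<in> \<E>" and N: "matching N" "N \<subseteq> X \<times> X" and le: "|N| \<le>o |E - Id|"
  shows "N \<union> Id_on X \<in> \<E>"
proof (cases "finite N")
  case True
  then show ?thesis using ent_finite N(2) by blast
next
  case False
  define S where "S = E O E\<inverse>"
  have S: "S \<in> \<E>" "sym S" "E \<subseteq> S" using ent_symmetrize[OF assms(1)] by (simp_all add: S_def)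
  obtain \<M> where \<M>: "finite \<M>" "\<And>M. M \<in> \<M> \<Longrightarrow> matching M" "S - Id = \<Union>\<M>"
    using ent_matching_cover[OF S(1,2)] by metis
  have "|N| \<le>o |\<Union>\<M>|"
    using le card_of_mono1[of "E - Id" "S - Id"] S(3) \<M>(3) ordLeq_transitive
    by (metis Diff_mono order_refl)
  moreover have "Cinfinite |N|"
    using False by (intro conjI card_of_Card_order) (simp add: cinfinite_def Field_card_of)
  \<comment> \<open>An infinite cardinal is not reached by a finite union of smaller sets, so a
    single matching inside \<open>S\<close> already has at least as many edges as
    \<open>N\<close>.\<close>
  ultimately obtain M where M: "M \<in> \<M>" "\<not> |M| <o |N|"
    using finite_Union_ordLess[of "|N|" \<M>] \<M>(1) not_ordLess_ordLeq by blast
  then have "|N| \<le>o |M|" by (simp add: ordLess_or_ordLeq not_ordLess_iff_ordLeq card_of_Well_order)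
  moreover have "M \<union> Id_on X \<in> \<E>" using ent_subset[OF S(1), of M] M(1) \<M>(3) by blast
  ultimately show ?thesis using ent_matching_le \<M>(2)[OF M(1)] N by blast
qed

text \<open>The graph of \<open>g\<close> is enlarged to a symmetric relation of bounded degree and
  cut into matchings. Each has its domain in the support of \<open>g\<close>, so it is small enough
  for \<open>ent_matching_le_ent\<close>.\<close>

lemma ent_graph:
  assumes "E \<in> \<E>" "g permutes X" "|supp X g| \<le>o |E - Id|"
  shows "{(x, g x) | x. x \<in> X} \<union> Id_on X \<in> \<E>"
proof -
  \<comment> \<open>Closure under inverses makes \<open>S\<close> symmetric, and \<open>id\<close>
    makes it reflexive on \<open>X\<close>.\<close>
  define H where "H = {id, g, inv g}"
  define S where "S = {(x, h x) | x h. x \<in> X \<and> h \<in> H}"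
  have perm: "h permutes X" if "h \<in> H" for h
    using that assms(2) by (auto simp: H_def permutes_inv permutes_id)
  have invH: "inv h \<in> H" if "h \<in> H" for h
    using that assms(2) by (auto simp: H_def permutes_inv_inv)
  have "sym S"
  proof (rule symI)
    fix x y assume "(x, y) \<in> S"
    then obtain h where h: "x \<in> X" "h \<in> H" "y = h x" by (auto simp: S_def)
    then have "y \<in> X" "x = inv h y"
      using perm[OF h(2)] by (auto simp: permutes_in_image permutes_inverses)
    then show "(y, x) \<in> S" using invH[OF h(2)] by (auto simp: S_def)
  qed
  moreover have subS: "S \<subseteq> X \<times> X" using perm by (auto simp: S_def permutes_in_image)
  moreover have "Id_on X \<subseteq> S" by (force simp: S_def H_def)
  \<comment> \<open>Two steps from \<open>x\<close> lead to a point \<open>h' (h x)\<close>, so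
    pairs from \<open>H\<close> bound the degree.\<close>
  moreover have "finite ((S O S) `` {x}) \<and> card ((S O S) `` {x}) \<le> card (H \<times> H)" if "x \<in> X" for x
  proof -
    have sub: "(S O S) `` {x} \<subseteq> (\<lambda>(h, h'). h' (h x)) ` (H \<times> H)" by (force simp: S_def)
    have "finite (H \<times> H)" by (simp add: H_def)
    then show ?thesis using sub by (meson finite_imageI finite_subset surj_card_le)
  qed
  ultimately obtain \<N> where \<N>: "finite \<N>" "\<And>N. N \<in> \<N> \<Longrightarrow> matching N" "S - Id = \<Union>\<N>"
    using matching_cover by metis
  have "N \<union> Id_on X \<in> \<E>" if "N \<in> \<N>" for N
  proof (rule ent_matching_le_ent[OF assms(1) \<N>(2)[OF that]])
    have NS: "N \<subseteq> S - Id" using that \<N>(3) by blast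
    then show "N \<subseteq> X \<times> X" using subS by blast
    have "Domain N \<subseteq> supp X g"
    proof (rule subsetI, elim DomainE)
      fix x y assume "(x, y) \<in> N"
      then have "(x, y) \<in> S" "x \<noteq> y" using NS by auto
      then show "x \<in> supp X g"
        using permutes_inv_eq[OF assms(2), of x x] by (auto simp: S_def H_def supp_def)
    qed
    then have "|N| \<le>o |supp X g|"
      using card_of_matching_parts(1)[OF \<N>(2)[OF that]] card_of_mono1 ordIso_ordLeq_trans
        ordIso_symmetric by blast
    then show "|N| \<le>o |E - Id|" using assms(3) ordLeq_transitive by blast
  qed
  then have "\<Union>\<N> \<union> Id_on X \<in> \<E>" using ent_finite_Union \<N>(1) by blast
  moreover have "{(x, g x) | x. x \<in> X} \<subseteq> \<Union>\<N> \<union> Id_on X"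
    unfolding \<N>(3)[symmetric] by (auto simp: S_def H_def)
  ultimately show ?thesis using ent_subset by blast
qed

lemma ent_cover_perms:
  assumes "E \<in> \<E>" "Cinfinite \<kappa>" and small: "\<And>E. E \<in> \<E> \<Longrightarrow> |E - Id| <o \<kappa>"
  shows "E \<in> group_coarse X (perms_below X \<kappa>)"
proof -
  define S where "S = E O E\<inverse>"
  have S: "S \<in> \<E>" "sym S" "E \<subseteq> S" using ent_symmetrize[OF assms(1)] by (simp_all add: S_def)
  obtain \<M> where \<M>: "finite \<M>" "\<And>M. M \<in> \<M> \<Longrightarrow> matching M" "S - Id = \<Union>\<M>"
    using ent_matching_cover[OF S(1,2)] by metis
  have idG: "id \<in> perms_below X \<kappa>"
    using transitive_perms_below[OF assms(2)] by (auto simp: transitive_permutation_group_def)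
  show ?thesis
  proof (rule group_coarseI[of "insert id (swap_along ` \<M>)"])
    have "swap_along M \<in> perms_below X \<kappa>" if "M \<in> \<M>" for M
    proof -
      have MS: "M \<subseteq> S - Id" using \<M>(3) that by blast
      then have "swap_along M permutes X"
        using swap_along_permutes[OF \<M>(2)[OF that], of X] ent_sub[OF S(1)] by blast
      moreover have "|supp X (swap_along M)| <o \<kappa>"
      proof -
        \<comment> \<open>The bound \<open>small\<close> is applied to the symmetrization
          \<open>S\<close>, of which \<open>M\<close> is a part, and not to \<open>E\<close>
          itself.\<close>
        have "|M| <o \<kappa>" using card_of_mono1[OF MS] small[OF S(1)] ordLeq_ordLess_trans by blast
        then have "|Domain M| <o \<kappa>" "|Range M| <o \<kappa>"
          unfolding fst_eq_Domain[symmetric] snd_eq_Range[symmetric]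
          using card_of_image ordLeq_ordLess_trans by blast+
        then have "|Field M| <o \<kappa>"
          unfolding Field_def using assms(2)
          by (intro card_of_Un_ordLess_infinite_Field) (auto simp: cinfinite_def)
        moreover have "supp X (swap_along M) \<subseteq> Field M"
          using swap_along(3)[OF \<M>(2)[OF that]] by (auto simp: supp_def)
        ultimately show ?thesis using card_of_mono1 ordLeq_ordLess_trans by blast
      qed
      ultimately show ?thesis by (simp add: perms_below_def)
    qed
    then show "insert id (swap_along ` \<M>) \<subseteq> perms_below X \<kappa>" using idG by blast
    show "E \<subseteq> {(x, g x) | x g. x \<in> X \<and> g \<in> insert id (swap_along ` \<M>)}"
    proof clarify
      fix x y assume xy: "(x, y) \<in> E"
      then have "x \<in> X" using ent_sub[OF assms(1)] by blast
      moreover have "\<exists>g\<in>insert id (swap_along ` \<M>). y = g x"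
      proof (cases "x = y")
        case False
        then obtain M where "M \<in> \<M>" "(x, y) \<in> M" using xy S(3) \<M>(3) by blast
        then show ?thesis using swap_along(1)[OF \<M>(2)] by (metis image_eqI insertI2)
      qed auto
      ultimately show "\<exists>x' g. (x, y) = (x', g x') \<and> x' \<in> X \<and> g \<in> insert id (swap_along ` \<M>)"
        by blast
    qed
  qed (use \<M>(1) ent_refl[OF assms(1)] in auto)
qed

lemma ex_cardinal:
  "\<exists>\<kappa> :: 'a set rel. Cinfinite \<kappa> \<and> \<kappa> \<le>o cardSuc |X| \<and> \<E> = group_coarse X (perms_below X \<kappa>)"
proof -
  \<comment> \<open>\<open>K\<close> collects the strict upper bounds of the off-diagonal sizes. It
    contains \<open>cardSuc |X|\<close>, and well-foundedness of the cardinal order provides a least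
    member.\<close>
  define K :: "'a set rel set" where "K = {\<kappa>. Card_order \<kappa> \<and> (\<forall>E\<in>\<E>. |E - Id| <o \<kappa>)}"
  have "|E - Id| <o cardSuc |X|" if "E \<in> \<E>" for E
  proof -
    have "|E - Id| \<le>o |X \<times> X|" using ent_sub[OF that] by (intro card_of_mono1) blast
    also have "|X \<times> X| =o |X|" using inf_X by (rule card_of_Times_same_infinite)
    also have "|X| <o cardSuc |X|" by (rule cardSuc_greater[OF card_of_Card_order])
    finally show ?thesis .
  qed
  then have SucK: "cardSuc |X| \<in> K" by (simp add: K_def cardSuc_Card_order card_of_Card_order)
  obtain \<kappa> where \<kappa>: "\<kappa> \<in> K" and min: "\<And>\<mu>. \<mu> <o \<kappa> \<Longrightarrow> \<mu> \<notin> K"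
    by (rule wfE_min[OF wf_ordLess SucK], rule that)
  have card: "Card_order \<kappa>" and small: "\<And>E. E \<in> \<E> \<Longrightarrow> |E - Id| <o \<kappa>"
    using \<kappa> by (auto simp: K_def)
  have wo: "Well_order \<kappa>" using card by (rule card_order_on_well_order_on)
  have le: "\<kappa> \<le>o cardSuc |X|"
  proof -
    have "Well_order (cardSuc |X| )"
      using cardSuc_Card_order[OF card_of_Card_order] by (rule card_order_on_well_order_on)
    then show ?thesis using min[of "cardSuc |X|"] SucK not_ordLess_iff_ordLeq[OF wo] by metis
  qed
  \<comment> \<open>Were \<kappa> finite, a star with exactly \<kappa> edges from one centre would
    be a finite, hence controlled, relation whose size is not below \<kappa>.\<close>
  have "infinite (Field \<kappa>)"
  proof
    assume fin: "finite (Field \<kappa>)"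
    obtain x where x: "x \<in> X" using inf_X by fastforce
    obtain B where B: "finite B" "card B = card (Field \<kappa>)" "B \<subseteq> X - {x}"
      using infinite_arbitrarily_large[of "X - {x}"] inf_X by auto
    have "{x} \<times> B \<union> Id_on X \<in> \<E>" using B x by (intro ent_finite) auto
    then have "|({x} \<times> B \<union> Id_on X) - Id| <o \<kappa>" by (rule small)
    moreover have "({x} \<times> B \<union> Id_on X) - Id = {x} \<times> B" using B(3) by auto
    ultimately have "|{x} \<times> B| <o \<kappa>" by simp
    moreover have "|{x} \<times> B| =o |Field \<kappa>|"
      using B fin bij_betw_iff_card[of "{x} \<times> B" "Field \<kappa>"]
      by (auto simp: card_cartesian_product card_of_ordIso[symmetric])
    moreover have "|Field \<kappa>| =o \<kappa>" using card by (rule card_of_Field_ordIso)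
    ultimately show False
      by (metis not_ordLess_ordIso ordIso_transitive)
  qed
  then have cinf: "Cinfinite \<kappa>" using card by (simp add: cinfinite_def)
  have graph: "{(x, g x) | x. x \<in> X} \<union> Id_on X \<in> \<E>" if g: "g \<in> perms_below X \<kappa>" for g
  proof -
    \<comment> \<open>Minimality of \<kappa> concerns cardinals on \<open>'a set\<close>, whereas
      the support lies in \<open>'a\<close>; singletons give an equipollent copy on the right
      type.\<close>
    define \<mu> where "\<mu> = |(\<lambda>x. {x}) ` supp X g|"
    have iso: "|supp X g| =o \<mu>"
      unfolding \<mu>_def by (rule card_of_ordIsoI[of "\<lambda>x. {x}"]) (simp add: bij_betw_def)
    then have "\<mu> <o \<kappa>"
      using g by (auto simp: perms_below_def intro: ordIso_ordLess_trans[OF ordIso_symmetric])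
    \<comment> \<open>As \<mu> is not a strict upper bound, some entourage has at least as many
      off-diagonal pairs as \<open>g\<close> has moved points.\<close>
    then have "\<mu> \<notin> K" by (rule min)
    then obtain E where E: "E \<in> \<E>" "\<not> |E - Id| <o \<mu>"
      by (auto simp: K_def \<mu>_def card_of_Card_order)
    then have "\<mu> \<le>o |E - Id|"
      unfolding \<mu>_def by (simp add: not_ordLess_iff_ordLeq[OF card_of_Well_order card_of_Well_order])
    then have "|supp X g| \<le>o |E - Id|" by (rule ordIso_ordLeq_trans[OF iso])
    then show ?thesis using ent_graph E(1) g by (simp add: perms_below_def)
  qed
  have "\<E> = group_coarse X (perms_below X \<kappa>)"
  proof (rule set_eqI, rule iffI)
    fix E assume "E \<in> \<E>"
    then show "E \<in> group_coarse X (perms_below X \<kappa>)" using cinf small by (rule ent_cover_perms)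
  next
    fix E assume "E \<in> group_coarse X (perms_below X \<kappa>)"
    then obtain F where F: "finite F" "F \<subseteq> perms_below X \<kappa>" "Id_on X \<subseteq> E"
      "E \<subseteq> {(x, g x) | x g. x \<in> X \<and> g \<in> F}"
      by (rule group_coarseE)
    let ?D = "\<Union>((\<lambda>g. {(x, g x) | x. x \<in> X}) ` F) \<union> Id_on X"
    have "?D \<in> \<E>" using F(1,2) graph by (intro ent_finite_Union) auto
    moreover have "E \<subseteq> ?D" using F(4) by blast
    ultimately show "E \<in> \<E>" using ent_down[of ?D E] F(3) by simp
  qed
  then show ?thesis using cinf le by blast
qed

end

section \<open>Invariance of the finitary structures of permutation groups\<close>

text \<open>Conjugation by \<open>f\<close> carries the support along \<open>f\<close>, so
  membership, which depends on its size only, is preserved.\<close>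

lemma perms_below_conjugate:
  assumes "f permutes X" "g \<in> perms_below X \<kappa>"
  shows "f \<circ> g \<circ> inv f \<in> perms_below X \<kappa>"
proof -
  have g: "g permutes X" "|supp X g| <o \<kappa>" using assms(2) by (auto simp: perms_below_def)
  have "supp X (f \<circ> g \<circ> inv f) \<subseteq> f ` supp X g"
  proof
    fix x assume x: "x \<in> supp X (f \<circ> g \<circ> inv f)"
    then have "inv f x \<in> supp X g"
      using assms(1) permutes_inverses(1)[OF assms(1)] permutes_in_image[OF permutes_inv[OF assms(1)]]
      by (auto simp: supp_def)
    then show "x \<in> f ` supp X g" using permutes_inverses(1)[OF assms(1)] by (metis image_eqI)
  qed
  then have "|supp X (f \<circ> g \<circ> inv f)| \<le>o |supp X g|"
    using card_of_mono1 card_of_image ordLeq_transitive by blast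
  then have "|supp X (f \<circ> g \<circ> inv f)| <o \<kappa>" using g(2) ordLeq_ordLess_trans by blast
  moreover have "f \<circ> g \<circ> inv f permutes X"
    using assms(1) g(1) by (intro permutes_compose permutes_inv)
  ultimately show ?thesis by (simp add: perms_below_def)
qed

text \<open>A pair \<open>(x, g x)\<close> is sent to \<open>(f x, f (g x))\<close>, which lies on
  the graph of the conjugate of \<open>g\<close> by \<open>f\<close>. Conjugating a finite set of
  permutations leaves it finite.\<close>

lemma macro_uniform_perms_below:
  assumes f: "f permutes X" and id: "id \<in> perms_below X \<kappa>"
  shows "macro_uniform X (group_coarse X (perms_below X \<kappa>)) X (group_coarse X (perms_below X \<kappa>)) f"
  unfolding macro_uniform_def
proof (intro conjI ballI)
  show "f ` X \<subseteq> X" using permutes_image[OF f] by simp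
next
  fix E assume "E \<in> group_coarse X (perms_below X \<kappa>)"
  then obtain F where F: "finite F" "F \<subseteq> perms_below X \<kappa>" "id \<in> F"
    "E \<subseteq> {(x, g x) | x g. x \<in> X \<and> g \<in> F}"
    by (rule group_coarseE)
  let ?F = "insert id ((\<lambda>g. f \<circ> g \<circ> inv f) ` F)"
  let ?E = "{(x, g x) | x g. x \<in> X \<and> g \<in> ?F}"
  have "?E \<in> group_coarse X (perms_below X \<kappa>)"
  proof (rule group_coarseI[of ?F])
    show "?F \<subseteq> perms_below X \<kappa>" using F(2) id perms_below_conjugate[OF f] by blast
    show "Id_on X \<subseteq> ?E" by force
  qed (use F(1) in simp_all)
  moreover have "(f x, f y) \<in> ?E" if "x \<in> X" "(x, y) \<in> E" for x y
  proof -
    obtain g where g: "g \<in> F" "y = g x" using F(4) \<open>(x, y) \<in> E\<close> by blast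
    have "f y = (f \<circ> g \<circ> inv f) (f x)" using g(2) permutes_inverses(2)[OF f] by simp
    moreover have "f x \<in> X" using that(1) permutes_in_image[OF f] by simp
    ultimately show ?thesis using g(1) by blast
  qed
  ultimately show "\<exists>E'\<in>group_coarse X (perms_below X \<kappa>). \<forall>x\<in>X. \<forall>y\<in>X. (x, y) \<in> E \<longrightarrow> (f x, f y) \<in> E'"
    by blast
qed

lemma asymorphism_perms_below:
  assumes f: "f permutes X" and \<kappa>: "Cinfinite \<kappa>"
  shows "asymorphism X (group_coarse X (perms_below X \<kappa>)) X (group_coarse X (perms_below X \<kappa>)) f"
proof -
  let ?\<E> = "group_coarse X (perms_below X \<kappa>)"
  have id: "id \<in> perms_below X \<kappa>"
    using transitive_perms_below[OF \<kappa>] by (auto simp: transitive_permutation_group_def)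
  \<comment> \<open>On \<open>X\<close> both inverses agree, which reduces the second half of the
    asymorphism to the previous lemma for \<open>inv f\<close>.\<close>
  have "inv_into X f x = inv f x" if "x \<in> X" for x
    using that permutes_inj_on[OF f] permutes_inverses(1)[OF f] permutes_in_image[OF permutes_inv[OF f]]
    by (intro inv_into_f_eq) simp_all
  then have "macro_uniform X ?\<E> X ?\<E> (inv_into X f)"
    using macro_uniform_perms_below[OF permutes_inv[OF f] id] by (simp add: macro_uniform_def)
  then show ?thesis
    unfolding asymorphism_def
    using permutes_imp_bij[OF f] macro_uniform_perms_below[OF f id] by blast
qed

text \<open>\<open>'a set rel\<close> is the type of \<open>cardSuc |X|\<close>; every cardinal up
  to the successor of |X| has a representative there, so the quantifier over \<kappa> misses
  none.\<close>

theorem theorem2: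
  fixes X :: "'a set" and \<E> :: "'a rel set"
  assumes "coarse_structure X \<E>" and "finitary X \<E>" and "infinite X"
  shows "(\<forall>f. f permutes X \<longrightarrow> asymorphism X \<E> X \<E> f) \<longleftrightarrow>
         (\<exists>\<kappa> :: 'a set rel. Cinfinite \<kappa> \<and> \<kappa> \<le>o cardSuc |X| \<and>
            \<E> = group_coarse X (perms_below X \<kappa>))"
proof
  assume "\<forall>f. f permutes X \<longrightarrow> asymorphism X \<E> X \<E> f"
  then interpret invariant_coarse X \<E> using assms by unfold_locales auto
  show "\<exists>\<kappa> :: 'a set rel. Cinfinite \<kappa> \<and> \<kappa> \<le>o cardSuc |X| \<and>
      \<E> = group_coarse X (perms_below X \<kappa>)"
    by (rule ex_cardinal)
next
  assume "\<exists>\<kappa> :: 'a set rel. Cinfinite \<kappa> \<and> \<kappa> \<le>o cardSuc |X| \<and>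
      \<E> = group_coarse X (perms_below X \<kappa>)"
  then show "\<forall>f. f permutes X \<longrightarrow> asymorphism X \<E> X \<E> f"
    using asymorphism_perms_below by blast
qed

end
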